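(* Let $D\subsetneq\mathbb{C}^n$, $n\geq 2$, be a bounded, starlike, weakly linearly convex domain. Then $D$ is holomorphic homogeneous regular, i.e. $\inf_{z\in D}s_D(z)>0$.
   Context: Squeezing function: write $B^n(0,r)$ for the open Euclidean ball of radius $r$ centred at $0$ in $\mathbb{C}^n$. For a bounded domain $D\subset\mathbb{C}^n$ and $z\in D$, $s_D(z):=\sup\{s_D(z;F) : F:D\to B^n(0,1)$ is an injective holomorphic map with $F(z)=0\}$, where $s_D(z;F):=\sup\{r>0 : B^n(0,r)\subset F(D)\}$. A bounded domain $D$ is holomorphic homogeneous regular if $\inf_{z\in D}s_D(z)>0$. A domain $D\subset\mathbb{C}^n$ is weakly linearly convex if for each $a\in\partial D$ there exists a (affine) complex hyperplane through $a$ that does not intersect $D$. $D$ is starlike if there is a point $p\in D$ such that for every $z\in D$ the line segment joining $p$ to $z$ is contained in $D$. *)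

theory Defs
  imports "HOL-Analysis.Analysis"
begin

text \<open>
  \<open>complex ^ 'n\<close> plays the role of \<open>\<complex>\<^sup>n\<close> with \<open>n = CARD('n)\<close>; its library norm is the Euclidean one,
  so \<open>ball 0 r\<close> is the Euclidean ball.
\<close>

definition bounded_domain :: "(complex ^ 'n) set \<Rightarrow> bool" where
  "bounded_domain D \<longleftrightarrow> open D \<and> connected D \<and> D \<noteq> {} \<and> bounded D"

text \<open>
  Complex differentiability: the Frechet derivative exists at each point and is \<open>\<complex>\<close>-linear,
  i.e. multiplication by a complex Jacobian matrix. Meant for open \<open>D\<close>.
\<close>

definition holomorphic_map_on :: "(complex ^ 'n \<Rightarrow> complex ^ 'm) \<Rightarrow> (complex ^ 'n) set \<Rightarrow> bool" where
  "holomorphic_map_on F D \<longleftrightarrow>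
     (\<forall>z\<in>D. \<exists>J :: complex ^ 'n ^ 'm. (F has_derivative (\<lambda>v. J *v v)) (at z))"

text \<open>
  The suprema and the infimum below are taken in \<open>real\<close>. When \<open>D\<close> is a bounded domain and \<open>z \<in> D\<close>,
  all the sets involved are nonempty and bounded: \<open>F ` D\<close> is open by invariance of domain, contains
  \<open>0 = F z\<close> and lies in the unit ball; and a rescaled translation of \<open>D\<close> is an admissible \<open>F\<close>.
\<close>

definition squeezing_radius ::
    "(complex ^ 'n) set \<Rightarrow> (complex ^ 'n \<Rightarrow> complex ^ 'n) \<Rightarrow> real" where
  "squeezing_radius D F = Sup {r. r > 0 \<and> ball 0 r \<subseteq> F ` D}"

definition squeezing_function :: "(complex ^ 'n) set \<Rightarrow> complex ^ 'n \<Rightarrow> real" where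
  "squeezing_function D z =
     Sup {squeezing_radius D F | F.
            holomorphic_map_on F D \<and> inj_on F D \<and> F ` D \<subseteq> ball 0 1 \<and> F z = 0}"

definition holomorphic_homogeneous_regular :: "(complex ^ 'n) set \<Rightarrow> bool" where
  "holomorphic_homogeneous_regular D \<longleftrightarrow>
     bounded_domain D \<and> (INF z\<in>D. squeezing_function D z) > 0"

definition complex_hyperplane :: "(complex ^ 'n) set \<Rightarrow> bool" where
  "complex_hyperplane H \<longleftrightarrow>
     (\<exists>c b. c \<noteq> 0 \<and> H = {z. (\<Sum>i\<in>UNIV. c $ i * z $ i) = b})"

definition weakly_linearly_convex :: "(complex ^ 'n) set \<Rightarrow> bool" where
  "weakly_linearly_convex D \<longleftrightarrow>
     (\<forall>a\<in>frontier D. \<exists>H. complex_hyperplane H \<and> a \<in> H \<and> H \<inter> D = {})"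

end

theory Submission
  imports Defs
begin

text \<open>
  Fix \<open>q \<in> D\<close>. Inductively pick vectors \<open>v\<^sub>k\<close> in the common kernel of the functionals \<open>l\<^sub>j\<close>, \<open>j < k\<close>,
  scaled so that the disc \<open>q + \<zeta> v\<^sub>k\<close>, \<open>\<bar>\<zeta>\<bar> < 1\<close>, lies in \<open>D\<close> and \<open>q + v\<^sub>k\<close> on its boundary, and let
  \<open>l\<^sub>k(z - q) = 1\<close> be a hyperplane through \<open>q + v\<^sub>k\<close> missing \<open>D\<close>. The matrix \<open>l\<^sub>j(v\<^sub>k)\<close> is unitriangular
  with entries bounded by \<open>1\<close>, so its inverse is bounded in terms of \<open>n\<close> only. The same bound applied
  to a hyperplane through any boundary point shows that \<open>D\<close> contains every \<open>q + \<Sum> t\<^sub>k v\<^sub>k\<close> with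
  \<open>\<Sum> \<bar>t\<^sub>k\<bar> < 1\<close>; hence the coordinates \<open>l\<^sub>k(z - q)\<close> fill a polydisc of uniform size. As \<open>D\<close> is starlike,
  each coordinate takes values in a plane slit along a ray from \<open>1\<close>, which a square root followed
  by a Cayley transform maps onto the unit disc with uniform control near \<open>0\<close>.
\<close>

section \<open>The slit plane mapped onto the unit disc\<close>

text \<open>
  The set \<open>(1 - w) / (1 - c) \<notin> \<real>\<^sub>\<le>\<^sub>0\<close> is the plane without the ray from \<open>1\<close> pointing away from \<open>c\<close>.
\<close>

definition slit_map :: "complex \<Rightarrow> complex \<Rightarrow> complex" where
  "slit_map c w = (csqrt ((1 - w) / (1 - c)) - csqrt (1 / (1 - c)))
                / (csqrt ((1 - w) / (1 - c)) + cnj (csqrt (1 / (1 - c))))"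

lemma slit_map_0 [simp]: "slit_map c 0 = 0"
  by (simp add: slit_map_def)

text \<open>The square root sends the slit plane to the right half-plane, and the second factor is
  the Cayley transform of that half-plane taking \<open>s0\<close> to 0. The constant 16 does not
  depend on \<open>c\<close>: inverting gives \<open>w = 1 - (\<sigma> / s0)\<^sup>2\<close>, where
  the ratio involves \<open>s0\<close> only through \<open>cnj s0 / s0\<close>, of modulus
  1.\<close>

lemma
  fixes c :: complex
  assumes c: "1 / (1 - c) \<notin> \<real>\<^sub>\<le>\<^sub>0"
  shows slit_map_field_differentiable:
      "\<And>w. (1 - w) / (1 - c) \<notin> \<real>\<^sub>\<le>\<^sub>0 \<Longrightarrow> slit_map c field_differentiable at w"
    and norm_slit_map_less_1: "\<And>w. (1 - w) / (1 - c) \<notin> \<real>\<^sub>\<le>\<^sub>0 \<Longrightarrow> norm (slit_map c w) < 1"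
    and inj_on_slit_map: "inj_on (slit_map c) {w. (1 - w) / (1 - c) \<notin> \<real>\<^sub>\<le>\<^sub>0}"
    and slit_map_small_preimage:
      "\<And>\<zeta>. norm \<zeta> \<le> 1/2 \<Longrightarrow> \<exists>w. slit_map c w = \<zeta> \<and> norm w \<le> 16 * norm \<zeta>"
proof -
  define s0 where "s0 = csqrt (1 / (1 - c))"
  define s where "s w = csqrt ((1 - w) / (1 - c))" for w
  have f_eq: "slit_map c w = (s w - s0) / (s w + cnj s0)" for w
    by (simp add: slit_map_def s_def s0_def)
  have c1: "1 - c \<noteq> 0" using c by auto
  \<comment> \<open>The principal root has nonnegative real part; were it 0, the square would lie on
    the removed ray.\<close>
  have pos: "Re (csqrt u) > 0" if "u \<notin> \<real>\<^sub>\<le>\<^sub>0" for u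
  proof (rule ccontr)
    assume "\<not> ?thesis"
    then have "Re (csqrt u) = 0" using csqrt_principal[of u] by linarith
    then have "(csqrt u)\<^sup>2 \<in> \<real>\<^sub>\<le>\<^sub>0"
      unfolding complex_nonpos_Reals_iff Re_power2 Im_power2 by simp
    then show False using that by simp
  qed
  have s0: "Re s0 > 0" and s0_sq: "s0\<^sup>2 = 1 / (1 - c)"
    using pos[OF c] by (simp_all add: s0_def)
  have s: "Re (s w) > 0" if "(1 - w) / (1 - c) \<notin> \<real>\<^sub>\<le>\<^sub>0" for w
    using pos[OF that] by (simp add: s_def)
  have den: "s w + cnj s0 \<noteq> 0" if "(1 - w) / (1 - c) \<notin> \<real>\<^sub>\<le>\<^sub>0" for w
    using s[OF that] s0 by (auto simp: complex_eq_iff)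
  show "slit_map c field_differentiable at w" if w: "(1 - w) / (1 - c) \<notin> \<real>\<^sub>\<le>\<^sub>0" for w
  proof -
    have "s field_differentiable at w"
      using has_field_derivative_csqrt'[of "\<lambda>w. (1 - w) / (1 - c)" "- 1 / (1 - c)" w UNIV] w c1
      unfolding s_def field_differentiable_def by (auto intro!: derivative_eq_intros)
    then show ?thesis
      unfolding f_eq[abs_def] by (intro field_differentiable_divide field_differentiable_diff
          field_differentiable_add field_differentiable_const den[OF w])
  qed
  show "norm (slit_map c w) < 1" if w: "(1 - w) / (1 - c) \<notin> \<real>\<^sub>\<le>\<^sub>0" for w
  proof -
    \<comment> \<open>The two squares differ by 4 Re (\<open>s w\<close>) Re
      \<open>s0\<close>.\<close>
    have "(norm (s w - s0))\<^sup>2 < (norm (s w + cnj s0))\<^sup>2"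
      using mult_pos_pos[OF s[OF w] s0]
      unfolding cmod_power2 by (simp add: power2_eq_square algebra_simps)
    then have "norm (s w - s0) < norm (s w + cnj s0)"
      by (rule power_less_imp_less_base) simp
    then show ?thesis
      using den[OF w] by (simp add: f_eq norm_divide)
  qed
  show "inj_on (slit_map c) {w. (1 - w) / (1 - c) \<notin> \<real>\<^sub>\<le>\<^sub>0}"
  proof (rule inj_onI, clarify)
    fix x y
    assume x: "(1 - x) / (1 - c) \<notin> \<real>\<^sub>\<le>\<^sub>0" and y: "(1 - y) / (1 - c) \<notin> \<real>\<^sub>\<le>\<^sub>0" and eq: "slit_map c x = slit_map c y"
    have "(s x - s0) * (s y + cnj s0) = (s y - s0) * (s x + cnj s0)"
      using eq den[OF x] den[OF y] by (simp add: f_eq frac_eq_eq)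
    then have "(s x - s y) * (s0 + cnj s0) = 0" by (simp add: algebra_simps)
    moreover have "s0 + cnj s0 \<noteq> 0" using s0 by (auto simp: complex_eq_iff)
    ultimately have "(s x)\<^sup>2 = (s y)\<^sup>2" by simp
    then show "x = y" using c1 by (simp add: s_def)
  qed
  show "\<exists>w. slit_map c w = \<zeta> \<and> norm w \<le> 16 * norm \<zeta>" if z: "norm \<zeta> \<le> 1/2" for \<zeta>
  proof (intro exI conjI)
    \<comment> \<open>Solution of \<open>\<zeta> = (\<sigma> - s0) / (\<sigma> + cnj s0)\<close>. It
      must have positive real part, so that \<open>csqrt\<close> recovers it from its
      square.\<close>
    define \<sigma> where "\<sigma> = (s0 + cnj s0 * \<zeta>) / (1 - \<zeta>)"
    define w where "w = 1 - (1 - c) * \<sigma>\<^sup>2"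
    have z1: "1 - \<zeta> \<noteq> 0" using z by auto
    have "Re ((s0 + cnj s0 * \<zeta>) * cnj (1 - \<zeta>)) = Re s0 * (1 - (norm \<zeta>)\<^sup>2)"
      unfolding cmod_power2 by (simp add: power2_eq_square algebra_simps)
    moreover have "(norm \<zeta>)\<^sup>2 < 1"
      using z by (simp add: power_less_one_iff)
    ultimately have "Re \<sigma> > 0"
      using s0 z1 by (simp add: \<sigma>_def complex_div_cnj[of _ "1 - \<zeta>"] Re_divide_of_real
          flip: of_real_power)
    then have "csqrt (\<sigma>\<^sup>2) = \<sigma>" by (simp add: csqrt_square)
    then have sw: "s w = \<sigma>" using c1 by (simp add: s_def w_def)
    have re: "s0 + cnj s0 \<noteq> 0" using s0 by (auto simp: complex_eq_iff)
    have "\<sigma> - s0 = \<zeta> * (s0 + cnj s0) / (1 - \<zeta>)" "\<sigma> + cnj s0 = (s0 + cnj s0) / (1 - \<zeta>)"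
      using z1 by (simp_all add: \<sigma>_def field_simps)
    then show "slit_map c w = \<zeta>" using re z1 by (simp add: f_eq sw)
    have s0n: "s0 \<noteq> 0" using s0 by auto
    \<comment> \<open>In terms of \<open>d\<close> one has \<open>w = - d * (d + 2)\<close>; here
      \<open>norm d\<close> is at most \<open>4 * norm \<zeta>\<close>, hence at most 2, and the
      second factor is at most 4.\<close>
    define d where "d = \<sigma> / s0 - 1"
    have "d = \<zeta> / (1 - \<zeta>) * (1 + cnj s0 / s0)"
      using s0n z1 by (simp add: d_def \<sigma>_def field_simps)
    moreover have "norm (1 + cnj s0 / s0) \<le> 2"
      using norm_triangle_ineq[of 1 "cnj s0 / s0"] s0n by (simp add: norm_divide)
    moreover have "norm (1 - \<zeta>) \<ge> 1/2"
      using norm_triangle_ineq2[of 1 \<zeta>] z by simp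
    then have "norm (\<zeta> / (1 - \<zeta>)) \<le> 2 * norm \<zeta>"
      using z1 mult_left_mono[of "1/2" "norm (1 - \<zeta>)" "2 * norm \<zeta>"]
      by (simp add: norm_divide field_simps)
    ultimately have d: "norm d \<le> 2 * norm \<zeta> * 2"
      by (simp only: norm_mult) (intro mult_mono, simp_all)
    have "1 - c = 1 / s0\<^sup>2" using s0_sq c1 by simp
    then have "w = 1 - (d + 1)\<^sup>2"
      by (simp add: w_def d_def power_divide)
    then have "w = - d * (d + 2)" by algebra
    then have "norm w = norm d * norm (d + 2)" by (simp add: norm_mult)
    also have "\<dots> \<le> (2 * norm \<zeta> * 2) * 4"
      using d z norm_triangle_ineq[of d 2] by (intro mult_mono) auto
    finally show "norm w \<le> 16 * norm \<zeta>" by simp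
  qed
qed

section \<open>The bilinear pairing and linear algebra\<close>

definition cdot :: "complex ^ 'n \<Rightarrow> complex ^ 'n \<Rightarrow> complex" where
  "cdot c z = (\<Sum>i\<in>UNIV. c $ i * z $ i)"

lemma cdot_simps [simp]:
  "cdot c (x + y) = cdot c x + cdot c y" "cdot c (x - y) = cdot c x - cdot c y"
  "cdot c (a *s x) = a * cdot c x" "cdot (a *s c) x = a * cdot c x" "cdot c 0 = 0"
  by (simp_all add: cdot_def algebra_simps sum.distrib sum_subtractf sum_distrib_left)

lemma cdot_scaleR [simp]: "cdot c (r *\<^sub>R x) = of_real r * cdot c x"
  by (simp add: cdot_def scaleR_sum_right flip: scaleR_conv_of_real)

lemma cdot_sum [simp]: "cdot c (\<Sum>k\<in>S. f k) = (\<Sum>k\<in>S. cdot c (f k))"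
  by (induction S rule: infinite_finite_induct) auto

lemma norm_scale: "norm (a *s x :: complex ^ 'n) = norm a * norm x"
  by (simp add: norm_vec_def L2_set_def norm_mult power_mult_distrib real_sqrt_mult
      flip: sum_distrib_left)

lemma continuous_on_scale [continuous_intros]:
  "continuous_on S f \<Longrightarrow> continuous_on S (\<lambda>x. f x *s (v :: complex ^ 'n))"
  unfolding vector_scalar_mult_def by (intro continuous_intros)

text \<open>Filling the rows outside \<open>S\<close> with zeros gives a square matrix whose row
  \<open>a\<close> vanishes; it is not surjective, hence has a nontrivial kernel.\<close>

lemma common_kernel:
  fixes l :: "'n::finite \<Rightarrow> complex ^ 'n"
  assumes "a \<notin> S"
  shows "\<exists>x. x \<noteq> 0 \<and> (\<forall>j\<in>S. cdot (l j) x = 0)"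
proof -
  define A where "A = (\<chi> j. if j \<in> S then l j else 0)"
  have A: "(A *v x) $ j = (if j \<in> S then cdot (l j) x else 0)" for x j
    by (simp add: A_def matrix_vector_mult_def cdot_def)
  have "\<not> surj ((*v) A)"
  proof
    assume "surj ((*v) A)"
    then obtain x where "A *v x = axis a 1" by (metis surjD)
    then show False using A[of x a] assms by (simp add: axis_def)
  qed
  then have "\<nexists>B. B ** A = mat 1"
    by (metis matrix_right_invertible_surjective matrix_left_right_inverse)
  then obtain x where "x \<noteq> 0" "A *v x = 0"
    unfolding matrix_left_invertible_ker by blast
  then show ?thesis using A by (metis zero_index)
qed

section \<open>Hyperplanes missing the domain and discs inside it\<close>

lemma weakly_linearly_convex_functional:
  assumes "weakly_linearly_convex D" "q \<in> D" "a \<in> frontier D"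
  obtains m where "cdot m (a - q) = 1" "\<And>z. z \<in> D \<Longrightarrow> cdot m (z - q) \<noteq> 1"
proof -
  obtain c b where ca: "cdot c a = b" and cD: "\<And>z. z \<in> D \<Longrightarrow> cdot c z \<noteq> b"
    using assms unfolding weakly_linearly_convex_def complex_hyperplane_def cdot_def by blast
  have b: "b - cdot c q \<noteq> 0" using cD[OF assms(2)] by auto
  show ?thesis
    by (rule that[of "(1 / (b - cdot c q)) *s c"])
      (use b ca cD in \<open>auto simp flip: diff_divide_distrib\<close>)
qed

text \<open>Otherwise the parameter \<open>inverse (cdot m x)\<close> lies in the unit disc and
  gives a point of \<open>D\<close> on the forbidden hyperplane.\<close>

lemma norm_cdot_le_1:
  assumes "\<And>\<zeta>. norm \<zeta> < 1 \<Longrightarrow> q + \<zeta> *s x \<in> D" "\<And>z. z \<in> D \<Longrightarrow> cdot m (z - q) \<noteq> 1"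
  shows "norm (cdot m x) \<le> 1"
proof (rule ccontr)
  assume gt: "\<not> ?thesis"
  then have "norm (inverse (cdot m x)) < 1" by (simp add: norm_inverse inverse_less_1_iff)
  then have "cdot m (q + inverse (cdot m x) *s x - q) \<noteq> 1" using assms by blast
  moreover have "cdot m x \<noteq> 0" using gt by auto
  ultimately show False by simp
qed

text \<open>Take for \<open>b\<close> a parameter of least modulus among those whose point on the
  complex line lies outside \<open>D\<close>.\<close>

lemma disc_touching_frontier:
  fixes D :: "(complex ^ 'n) set"
  assumes "open D" "bounded D" "q \<in> D" "x \<noteq> 0"
  obtains b where "q + b *s x \<in> frontier D" "\<And>\<zeta>. norm \<zeta> < 1 \<Longrightarrow> q + \<zeta> *s (b *s x) \<in> D"
proof -
  define C where "C = (\<lambda>\<zeta>. q + \<zeta> *s x) -` (- D)"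
  have "closed C"
    unfolding C_def using assms(1)
    by (intro closed_vimage) (auto intro!: continuous_intros)
  moreover have "C \<noteq> {}"
  proof -
    obtain B where B: "\<And>z. z \<in> D \<Longrightarrow> norm z \<le> B" using assms(2) bounded_iff by blast
    define r where "r = (B + norm q + 1) / norm x"
    have "B \<ge> 0" using order_trans[OF norm_ge_zero B[OF assms(3)]] .
    then have r: "r * norm x = B + norm q + 1" "r \<ge> 0"
      using assms(4) by (auto simp: r_def)
    have "norm (of_real r *s x) = B + norm q + 1" using r by (simp add: norm_scale)
    then have "norm (q + of_real r *s x) > B"
      using norm_triangle_ineq4[of "q + of_real r *s x" q] by simp
    then have "of_real r \<in> C" using B[of "q + of_real r *s x"] by (auto simp: C_def)
    then show ?thesis by blast
  qed
  ultimately obtain b where b: "b \<in> C" "\<And>\<zeta>. \<zeta> \<in> C \<Longrightarrow> norm b \<le> norm \<zeta>"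
    by (metis distance_attains_inf dist_0_norm)
  have b0: "b \<noteq> 0" using b(1) assms(3) by (auto simp: C_def)
  have disc: "q + \<zeta> *s (b *s x) \<in> D" if "norm \<zeta> < 1" for \<zeta>
  proof (rule ccontr)
    assume "\<not> ?thesis"
    then have "norm b \<le> norm (\<zeta> * b)" by (intro b(2)) (simp add: C_def vector_smult_assoc)
    then show False using that b0 by (simp add: norm_mult)
  qed
  \<comment> \<open>The point is the limit of the points with parameter \<open>t * b\<close> in
    \<open>D\<close> as \<open>t\<close> increases to 1.\<close>
  have "q + b *s x \<in> closure D"
  proof (rule Lim_in_closed_set[OF closed_closure])
    show "\<forall>\<^sub>F t in at_left (1::real). q + of_real t *s (b *s x) \<in> closure D"
      using eventually_at_left_real[of 0 "1::real"]
    proof (rule eventually_mono)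
      show "q + of_real t *s (b *s x) \<in> closure D" if "t \<in> {0<..<1}" for t
        using disc[of "of_real t"] that closure_subset by force
    qed simp
    have "continuous_on UNIV (\<lambda>t::real. q + of_real t *s (b *s x))"
      by (intro continuous_intros)
    from this[unfolded continuous_on_def, THEN bspec, of 1]
    have "((\<lambda>t. q + of_real t *s (b *s x)) \<longlongrightarrow> q + b *s x) (at (1::real))"
      by simp
    then show "((\<lambda>t. q + of_real t *s (b *s x)) \<longlongrightarrow> q + b *s x) (at_left (1::real))"
      by (rule tendsto_within_subset) simp
  qed auto
  then have "q + b *s x \<in> frontier D"
    using b(1) assms(1) by (simp add: frontier_def interior_open C_def)
  then show ?thesis using disc that by blast
qed

section \<open>Adapted frames and the diamond they span\<close>

text \<open>
  The last clause solves the triangular system \<open>l\<^sub>j(\<Sum> t\<^sub>k v\<^sub>k) = w\<^sub>j\<close> with a bound on the solution.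
  Unlike triangularity it does not mention an order on the index set, so that the
  induction can run over finite sets of indices.
\<close>

definition adapted_frame ::
    "(complex ^ 'n) set \<Rightarrow> complex ^ 'n \<Rightarrow> 'n set \<Rightarrow> ('n \<Rightarrow> complex ^ 'n) \<Rightarrow> ('n \<Rightarrow> complex ^ 'n) \<Rightarrow> bool"
where
  "adapted_frame D q S v l \<longleftrightarrow>
    (\<forall>k\<in>S. (\<forall>\<zeta>. norm \<zeta> < 1 \<longrightarrow> q + \<zeta> *s v k \<in> D) \<and> (\<forall>z\<in>D. cdot (l k) (z - q) \<noteq> 1)) \<and>
    (\<forall>w \<delta>. \<delta> \<ge> 0 \<longrightarrow> (\<forall>j\<in>S. norm (w j) \<le> \<delta>) \<longrightarrow>
      (\<exists>t. (\<forall>j\<in>S. cdot (l j) (\<Sum>k\<in>S. t k *s v k) = w j) \<and>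
           (\<Sum>k\<in>S. norm (t k)) \<le> (2 ^ card S - 1) * \<delta>))"

text \<open>The new vector is killed by the old functionals, so adding a multiple of it keeps the
  old equations, and the multiple is then fixed by the new one.\<close>

lemma adapted_frame_exists:
  fixes D :: "(complex ^ 'n) set" and S :: "'n set"
  assumes D: "open D" "bounded D" "q \<in> D" "weakly_linearly_convex D"
  shows "\<exists>v l. adapted_frame D q S v l"
  using finite[of S]
proof (induction S rule: finite_induct)
  case empty
  then show ?case by (simp add: adapted_frame_def)
next
  case (insert a S)
  obtain v l where IH: "adapted_frame D q S v l"
    using insert.IH by blast
  have disc: "q + \<zeta> *s v k \<in> D" if "k \<in> S" "norm \<zeta> < 1" for k \<zeta>
    using IH that unfolding adapted_frame_def by blast
  have avoid: "cdot (l k) (z - q) \<noteq> 1" if "k \<in> S" "z \<in> D" for k z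
    using IH that unfolding adapted_frame_def by blast
  obtain x where x: "x \<noteq> 0" "\<And>j. j \<in> S \<Longrightarrow> cdot (l j) x = 0"
    using common_kernel[OF insert.hyps(2)] by blast
  obtain b where b: "q + b *s x \<in> frontier D" "\<And>\<zeta>. norm \<zeta> < 1 \<Longrightarrow> q + \<zeta> *s (b *s x) \<in> D"
    using disc_touching_frontier[OF D(1,2,3) x(1)] by metis
  obtain m where "cdot m (q + b *s x - q) = 1" and mD: "\<And>z. z \<in> D \<Longrightarrow> cdot m (z - q) \<noteq> 1"
    using weakly_linearly_convex_functional[OF D(4,3) b(1)] by metis
  then have m: "cdot m (b *s x) = 1" by simp
  have mv: "norm (cdot m (v k)) \<le> 1" if "k \<in> S" for k
    using that disc mD by (intro norm_cdot_le_1[where D = D and q = q]) auto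
  let ?v = "v(a := b *s x)" and ?l = "l(a := m)"
  have "\<exists>t. (\<forall>j\<in>insert a S. cdot (?l j) (\<Sum>k\<in>insert a S. t k *s ?v k) = w j) \<and>
           (\<Sum>k\<in>insert a S. norm (t k)) \<le> (2 ^ card (insert a S) - 1) * \<delta>"
    if \<delta>: "\<delta> \<ge> 0" and w: "\<forall>j\<in>insert a S. norm (w j) \<le> \<delta>" for w \<delta>
  proof -
    obtain t where t: "\<And>j. j \<in> S \<Longrightarrow> cdot (l j) (\<Sum>k\<in>S. t k *s v k) = w j"
      "(\<Sum>k\<in>S. norm (t k)) \<le> (2 ^ card S - 1) * \<delta>"
      using IH \<delta> w unfolding adapted_frame_def by blast
    \<comment> \<open>The error left in equation \<open>a\<close>; as
      \<open>cdot m (b *s x) = 1\<close>, this multiple of the new vector corrects it.\<close>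
    define \<tau> where "\<tau> = w a - cdot m (\<Sum>k\<in>S. t k *s v k)"
    let ?t = "t(a := \<tau>)"
    have eq: "(\<Sum>k\<in>insert a S. ?t k *s ?v k) = \<tau> *s (b *s x) + (\<Sum>k\<in>S. t k *s v k)"
      using insert.hyps by (auto intro!: sum.cong)
    have solves: "cdot (?l j) (\<Sum>k\<in>insert a S. ?t k *s ?v k) = w j" if "j \<in> insert a S" for j
    proof (cases "j = a")
      case True
      then have "cdot (?l j) (\<Sum>k\<in>insert a S. ?t k *s ?v k)
          = \<tau> * cdot m (b *s x) + cdot m (\<Sum>k\<in>S. t k *s v k)"
        unfolding eq by simp
      then show ?thesis using True m by (simp only: \<tau>_def) simp
    next
      case False
      then have "j \<in> S" using that by simp
      then show ?thesis using False t(1)[of j] x(2)[of j] unfolding eq by simp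
    qed
    have "norm (cdot m (\<Sum>k\<in>S. t k *s v k)) \<le> (\<Sum>k\<in>S. norm (t k))"
      unfolding cdot_sum
      by (rule sum_norm_le) (use mv in \<open>auto simp: norm_mult intro: mult_left_le\<close>)
    then have "norm \<tau> \<le> \<delta> + (\<Sum>k\<in>S. norm (t k))"
      using w norm_triangle_ineq4[of "w a" "cdot m (\<Sum>k\<in>S. t k *s v k)"]
      unfolding \<tau>_def by force
    moreover have "(\<Sum>k\<in>S. norm (?t k)) = (\<Sum>k\<in>S. norm (t k))"
      using insert.hyps by (intro sum.cong) auto
    \<comment> \<open>This is the recursion 2 (2^k - 1) + 1 = 2^(k+1) - 1 behind the bound in
      \<open>adapted_frame\<close>.\<close>
    ultimately have "(\<Sum>k\<in>insert a S. norm (?t k)) \<le> \<delta> + 2 * (\<Sum>k\<in>S. norm (t k))"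
      using insert.hyps by simp
    then have "(\<Sum>k\<in>insert a S. norm (?t k)) \<le> (2 ^ card (insert a S) - 1) * \<delta>"
      using t(2) insert.hyps by (simp add: algebra_simps)
    with solves show ?thesis by blast
  qed
  moreover have "\<forall>k\<in>insert a S. (\<forall>\<zeta>. norm \<zeta> < 1 \<longrightarrow> q + \<zeta> *s ?v k \<in> D) \<and>
      (\<forall>z\<in>D. cdot (?l k) (z - q) \<noteq> 1)"
    using disc avoid b(2) mD by auto
  ultimately have "adapted_frame D q (insert a S) ?v ?l"
    unfolding adapted_frame_def by blast
  then show ?case by blast
qed

text \<open>If the point were outside, the segment from \<open>q\<close> would meet the frontier.
  The functional \<open>m\<close> there has modulus at least 1 on \<open>?x\<close>, yet at most 1
  on each \<open>v k\<close>, which forces the sum of the \<open>norm (t k)\<close> to be at least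
  1.\<close>

lemma diamond_subset:
  fixes D :: "(complex ^ 'n) set" and v :: "'n \<Rightarrow> complex ^ 'n"
  assumes D: "q \<in> D" "weakly_linearly_convex D"
    and disc: "\<And>k \<zeta>. norm \<zeta> < 1 \<Longrightarrow> q + \<zeta> *s v k \<in> D"
    and t: "(\<Sum>k\<in>UNIV. norm (t k)) < 1"
  shows "q + (\<Sum>k\<in>UNIV. t k *s v k) \<in> D"
proof (rule ccontr)
  let ?x = "\<Sum>k\<in>UNIV. t k *s v k"
  assume "q + ?x \<notin> D"
  then have "closed_segment q (q + ?x) \<inter> frontier D \<noteq> {}"
    using D(1) by (intro connected_Int_frontier) auto
  then obtain s where s: "0 \<le> s" "s \<le> 1" "q + s *\<^sub>R ?x \<in> frontier D"
    by (auto simp: in_segment algebra_simps)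
  obtain m where "cdot m (q + s *\<^sub>R ?x - q) = 1" and mD: "\<And>z. z \<in> D \<Longrightarrow> cdot m (z - q) \<noteq> 1"
    using weakly_linearly_convex_functional[OF D(2,1) s(3)] by metis
  then have "norm (of_real s * cdot m ?x) = 1" by (simp del: cdot_sum)
  then have "norm (cdot m ?x) \<ge> 1"
    using s mult_left_le_one_le[of "norm (cdot m ?x)" s] by (simp add: norm_mult)
  moreover have "norm (cdot m (v k)) \<le> 1" for k
    using disc mD by (intro norm_cdot_le_1[where D = D and q = q]) auto
  then have "norm (cdot m ?x) \<le> (\<Sum>k\<in>UNIV. norm (t k))"
    unfolding cdot_sum by (intro sum_norm_le) (auto simp: norm_mult intro: mult_left_le)
  ultimately show False using t by simp
qed


section \<open>Holomorphy, and how one map bounds the squeezing function\<close>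

lemma holomorphic_map_on_vec_lambda:
  fixes g :: "'m::finite \<Rightarrow> complex \<Rightarrow> complex" and l :: "'m \<Rightarrow> complex ^ 'n"
  assumes "\<And>j z. z \<in> D \<Longrightarrow> g j field_differentiable at (cdot (l j) (z - q))"
  shows "holomorphic_map_on (\<lambda>z. \<chi> j. g j (cdot (l j) (z - q))) D"
  unfolding holomorphic_map_on_def
proof
  fix z assume "z \<in> D"
  then obtain g' where g': "\<And>j. (g j has_field_derivative g' j) (at (cdot (l j) (z - q)))"
    using assms unfolding field_differentiable_def by metis
  define J :: "complex ^ 'n ^ 'm" where "J = (\<chi> j. g' j *s l j)"
  have J: "(J *v x) $ j = g' j * cdot (l j) x" for x j
    by (simp add: J_def matrix_vector_mult_def cdot_def sum_distrib_left mult_ac)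
  have "((\<lambda>z. g j (cdot (l j) (z - q))) has_derivative (\<lambda>x. (J *v x) $ j)) (at z)" for j
  proof -
    have "bounded_linear (cdot (l j))"
      by (rule linear_conv_bounded_linear[THEN iffD1], rule linearI) (simp_all flip: scaleR_conv_of_real)
    then have "((\<lambda>z. cdot (l j) (z - q)) has_derivative cdot (l j)) (at z)"
      by (rule bounded_linear.has_derivative) (auto intro!: derivative_eq_intros)
    then show ?thesis
      unfolding J
      by (rule has_derivative_compose) (rule g'[unfolded has_field_derivative_def])
  qed
  then have "((\<lambda>z. \<chi> j. g j (cdot (l j) (z - q))) has_derivative (\<lambda>x. J *v x)) (at z)"
    unfolding has_derivative_at_within by (auto intro!: vec_tendstoI)
  then show "\<exists>J :: complex ^ 'n ^ 'm.
      ((\<lambda>z. \<chi> j. g j (cdot (l j) (z - q))) has_derivative (\<lambda>x. J *v x)) (at z)"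
    by blast
qed

lemma le_squeezing_function:
  fixes F :: "complex ^ 'n \<Rightarrow> complex ^ 'n"
  assumes "open D" "z \<in> D"
    and F: "holomorphic_map_on F D" "inj_on F D" "F ` D \<subseteq> ball 0 1" "F z = 0"
    and r: "r > 0" "ball 0 r \<subseteq> F ` D"
  shows "r \<le> squeezing_function D z"
proof -
  have le_1: "s \<le> 1" if "ball 0 s \<subseteq> G ` D" "G ` D \<subseteq> ball 0 1"
    for s and G :: "complex ^ 'n \<Rightarrow> complex ^ 'n"
    using order_trans[OF that] by (auto simp: ball_subset_ball_iff)
  have radius_le_1: "squeezing_radius D G \<le> 1"
    if G: "holomorphic_map_on G D" "inj_on G D" "G ` D \<subseteq> ball 0 1" "G z = 0" for G
  proof -
    have "continuous_on D G"
      using G(1) has_derivative_continuous continuous_at_imp_continuous_on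
      unfolding holomorphic_map_on_def by blast
    \<comment> \<open>Bounding the real supremum by \<open>cSup_least\<close> requires some
      admissible radius; openness of the image around 0 supplies one.\<close>
    then have "open (G ` D)"
      using assms(1) G(2) by (intro invariance_of_domain_gen) auto
    moreover have "0 \<in> G ` D" using G(4) assms(2) by force
    ultimately obtain e where "e > 0" "ball 0 e \<subseteq> G ` D" using open_contains_ball by blast
    then show ?thesis
      unfolding squeezing_radius_def by (intro cSup_least) (use le_1 G(3) in auto)
  qed
  have "r \<le> squeezing_radius D F"
    unfolding squeezing_radius_def
    by (rule cSup_upper) (use r le_1 F(3) in \<open>auto intro!: bdd_aboveI[of _ 1]\<close>)
  also have "\<dots> \<le> squeezing_function D z"
    unfolding squeezing_function_def
    by (rule cSup_upper) (use F radius_le_1 in \<open>auto intro!: bdd_aboveI[of _ 1]\<close>)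
  finally show ?thesis .
qed

section \<open>The map into the ball and the uniform bound\<close>

text \<open>If the quotient were some \<open>s \<le> 0\<close>, then along the segment from
  \<open>p\<close> to \<open>z\<close> the value of 1 minus the functional would be
  \<open>((1 - t) + t * s) * (1 - ?c)\<close>, which vanishes at \<open>t = 1 / (1 - s)\<close>,
  inside \<open>D\<close>.\<close>

lemma starlike_functional_avoids_ray:
  assumes "closed_segment p z \<subseteq> D" "z \<in> D" "\<And>z. z \<in> D \<Longrightarrow> cdot m (z - q) \<noteq> 1"
  shows "(1 - cdot m (z - q)) / (1 - cdot m (p - q)) \<notin> \<real>\<^sub>\<le>\<^sub>0"
proof
  let ?w = "cdot m (z - q)" and ?c = "cdot m (p - q)"
  assume "(1 - ?w) / (1 - ?c) \<in> \<real>\<^sub>\<le>\<^sub>0"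
  then obtain s where s: "s \<le> 0" "(1 - ?w) / (1 - ?c) = of_real s"
    by (auto elim: nonpos_Reals_cases)
  define t where "t = 1 / (1 - s)"
  have t: "0 \<le> t" "t \<le> 1" using s(1) by (auto simp: t_def)
  have c: "1 - ?c \<noteq> 0" using assms(1,3) by force
  have w: "?w = 1 - of_real s * (1 - ?c)" using s(2) c by (simp add: field_simps)
  have "(1 - t) + t * s = 0" using s(1) by (simp add: t_def field_simps)
  then have L: "of_real t * of_real s = (of_real t - 1 :: complex)"
    by (metis add.commute add_diff_cancel_left' diff_0 minus_diff_eq of_real_1 of_real_diff of_real_mult)
  have "cdot m (((1 - t) *\<^sub>R p + t *\<^sub>R z) - q) = (1 - of_real t) * ?c + of_real t * ?w"
    by (simp add: algebra_simps)
  also have "\<dots> = (1 - of_real t) * ?c + of_real t - of_real t * of_real s * (1 - ?c)"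
    unfolding w by (simp add: algebra_simps)
  also have "\<dots> = 1"
    unfolding L by (simp add: algebra_simps)
  finally have "cdot m (((1 - t) *\<^sub>R p + t *\<^sub>R z) - q) = 1" .
  moreover have "(1 - t) *\<^sub>R p + t *\<^sub>R z \<in> D"
    by (rule subsetD[OF assms(1)]) (use t in \<open>auto simp: in_segment\<close>)
  ultimately show False using assms(3) by blast
qed

text \<open>For \<open>y\<close> in the small ball, the factor 16 of the slit maps leaves
  coordinates \<open>w j\<close> of size at most 1 / (2 * 2^n). Solving in the frame costs a factor
  2^n - 1, so the coefficients sum to less than 1 and \<open>diamond_subset\<close> applies.\<close>

lemma squeezing_function_lower_bound:
  fixes D :: "(complex ^ 'n) set"
  assumes D: "open D" "bounded D" "weakly_linearly_convex D" "starlike D" and q: "q \<in> D"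
  shows "1 / (32 * 2 ^ CARD('n) * real CARD('n)) \<le> squeezing_function D q"
proof -
  let ?n = "real CARD('n)"
  have n: "?n \<ge> 1" by (simp add: Suc_leI)
  obtain v l where vl: "adapted_frame D q UNIV v l"
    using adapted_frame_exists[OF D(1,2) q D(3)] by blast
  have disc: "q + \<zeta> *s v k \<in> D" if "norm \<zeta> < 1" for k \<zeta>
    using vl that unfolding adapted_frame_def by blast
  have avoid: "cdot (l k) (z - q) \<noteq> 1" if "z \<in> D" for k z
    using vl that unfolding adapted_frame_def by blast
  have solve: "\<exists>t. (\<forall>j. cdot (l j) (\<Sum>k\<in>UNIV. t k *s v k) = w j) \<and>
           (\<Sum>k\<in>UNIV. norm (t k)) \<le> (2 ^ CARD('n) - 1) * \<delta>"
    if "\<delta> \<ge> 0" "\<forall>j. norm (w j) \<le> \<delta>" for w \<delta>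
    using vl that unfolding adapted_frame_def by blast
  obtain p where p: "p \<in> D" "\<And>z. z \<in> D \<Longrightarrow> closed_segment p z \<subseteq> D"
    using D(4) unfolding starlike_def by blast
  define c where "c j = cdot (l j) (p - q)" for j
  have slit: "(1 - cdot (l j) (z - q)) / (1 - c j) \<notin> \<real>\<^sub>\<le>\<^sub>0" if "z \<in> D" for j z
    unfolding c_def using p(2)[OF that] that avoid by (rule starlike_functional_avoids_ray)
  define f where "f j = slit_map (c j)" for j
  have c: "1 / (1 - c j) \<notin> \<real>\<^sub>\<le>\<^sub>0" for j using slit[OF q, of j] by simp
  note f_diff = slit_map_field_differentiable[OF c, folded f_def]
    and f_less = norm_slit_map_less_1[OF c, folded f_def]
    and f_inj = inj_on_slit_map[OF c, folded f_def]
    and f_onto = slit_map_small_preimage[OF c, folded f_def]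
  have f_0: "f j 0 = 0" for j by (simp add: f_def)
  \<comment> \<open>Dividing by the dimension puts the image of the polydisc inside the Euclidean
    ball.\<close>
  define F where "F z = (\<chi> j. f j (cdot (l j) (z - q)) / of_real ?n)" for z
  \<comment> \<open>Solvability in the frame makes the square matrix with rows \<open>l j\<close>
    surjective, hence injective.\<close>
  have l_inj: "x = y" if eq: "\<And>j. cdot (l j) x = cdot (l j) y" for x y
  proof -
    define L where "L = (\<chi> j. l j)"
    have L: "(L *v x) $ j = cdot (l j) x" for x j
      by (simp add: L_def matrix_vector_mult_def cdot_def)
    have "surj ((*v) L)"
      unfolding surj_def
    proof
      fix y :: "complex ^ 'n"
      have "\<forall>j. norm (y $ j) \<le> norm y" by (simp add: Finite_Cartesian_Product.norm_nth_le)
      then obtain t where "\<And>j. cdot (l j) (\<Sum>k\<in>UNIV. t k *s v k) = y $ j"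
        using solve[of "norm y" "($) y"] by auto
      then have "L *v (\<Sum>k\<in>UNIV. t k *s v k) = y" by (simp add: vec_eq_iff L del: cdot_sum)
      then show "\<exists>x. y = L *v x" by metis
    qed
    then have "inj ((*v) L)"
      by (metis matrix_right_invertible_surjective matrix_left_invertible_injective
          matrix_left_right_inverse)
    moreover have "L *v x = L *v y" by (simp add: vec_eq_iff L eq)
    ultimately show ?thesis by (simp add: inj_eq)
  qed
  have "holomorphic_map_on F D"
    unfolding F_def
    by (rule holomorphic_map_on_vec_lambda[where g = "\<lambda>j w. f j w / of_real ?n"])
      (intro field_differentiable_divide field_differentiable_const f_diff slit, simp_all)
  moreover have "inj_on F D"
  proof (rule inj_onI)
    fix x y assume xy: "x \<in> D" "y \<in> D" "F x = F y"
    have "cdot (l j) (x - q) = cdot (l j) (y - q)" for j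
    proof (rule inj_onD[OF f_inj])
      show "f j (cdot (l j) (x - q)) = f j (cdot (l j) (y - q))"
        using arg_cong[OF xy(3), of "\<lambda>u. u $ j"] by (simp add: F_def del: cdot_simps)
    qed (simp_all only: mem_Collect_eq slit[OF xy(1)] slit[OF xy(2)] not_False_eq_True)
    then have "x - q = y - q" by (rule l_inj)
    then show "x = y" by simp
  qed
  moreover have "F ` D \<subseteq> ball 0 1"
  proof clarify
    fix z assume z: "z \<in> D"
    have "norm (F z) \<le> (\<Sum>j\<in>UNIV. norm (F z $ j))"
      unfolding norm_vec_def by (rule L2_set_le_sum) simp
    also have "\<dots> < (\<Sum>j\<in>(UNIV :: 'n set). 1 / ?n)"
      using f_less[OF slit[OF z]] n
      by (intro sum_strict_mono) (auto simp: F_def norm_divide divide_strict_right_mono)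
    finally show "F z \<in> ball 0 1" by simp
  qed
  moreover have "F q = 0" by (simp add: F_def f_0 vec_eq_iff)
  moreover have "ball 0 (1 / (32 * 2 ^ CARD('n) * ?n)) \<subseteq> F ` D"
  proof
    fix y :: "complex ^ 'n" assume "y \<in> ball 0 (1 / (32 * 2 ^ CARD('n) * ?n))"
    then have "?n * norm y \<le> 1 / (32 * 2 ^ CARD('n))"
      using n by (simp add: field_simps)
    moreover have "norm (of_real ?n * y $ j) \<le> ?n * norm y" for j
      by (simp add: norm_mult Finite_Cartesian_Product.norm_nth_le mult_left_mono)
    ultimately have y: "norm (of_real ?n * y $ j) \<le> 1 / (32 * 2 ^ CARD('n))" for j
      using order_trans by blast
    have "(1::real) \<le> 2 ^ CARD('n)" by simp
    then have "1 / (32 * 2 ^ CARD('n)) \<le> (1/2 :: real)" by (intro frac_le) linarith+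
    then have "norm (of_real ?n * y $ j) \<le> 1/2" for j using y order_trans by blast
    then have "\<forall>j. \<exists>u. f j u = of_real ?n * y $ j \<and> norm u \<le> 16 * norm (of_real ?n * y $ j)"
      using f_onto by blast
    from choice[OF this] obtain w where w: "\<And>j. f j (w j) = of_real ?n * y $ j"
      "\<And>j. norm (w j) \<le> 16 * norm (of_real ?n * y $ j)"
      by blast
    have w_le: "norm (w j) \<le> 1 / (2 * 2 ^ CARD('n))" for j
    proof -
      have "norm (w j) \<le> 16 * (1 / (32 * 2 ^ CARD('n)))"
        using w(2)[of j] y[of j] by linarith
      then show ?thesis by simp
    qed
    have "0 \<le> 1 / (2 * 2 ^ CARD('n) :: real)" by simp
    then obtain t where t: "\<And>j. cdot (l j) (\<Sum>k\<in>UNIV. t k *s v k) = w j"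
      "(\<Sum>k\<in>UNIV. norm (t k)) \<le> (2 ^ CARD('n) - 1) * (1 / (2 * 2 ^ CARD('n)))"
      using solve[of "1 / (2 * 2 ^ CARD('n))" w] w_le by blast
    note t(2)
    also have "(2 ^ CARD('n) - 1) * (1 / (2 * 2 ^ CARD('n))) < (1::real)"
      by (simp add: field_simps add_pos_pos)
    finally have "q + (\<Sum>k\<in>UNIV. t k *s v k) \<in> D"
      using diamond_subset[OF q D(3), of v t] disc by blast
    moreover have "F (q + (\<Sum>k\<in>UNIV. t k *s v k)) = y"
      using n by (simp add: F_def t(1) w(1) vec_eq_iff del: cdot_sum)
    ultimately show "y \<in> F ` D" by blast
  qed
  ultimately show ?thesis
    using n by (intro le_squeezing_function[OF D(1) q]) auto
qed

theorem theorem1p6: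
  fixes D :: "(complex ^ 'n) set"
  assumes "CARD('n) \<ge> 2"
    and "D \<noteq> UNIV"
    and "bounded_domain D"
    and "starlike D"
    and "weakly_linearly_convex D"
  shows "holomorphic_homogeneous_regular D"
proof -
  have D: "open D" "bounded D" "D \<noteq> {}"
    using assms(3) by (auto simp: bounded_domain_def)
  have "0 < 1 / (32 * 2 ^ CARD('n) * real CARD('n))" by simp
  also have "\<dots> \<le> (INF z\<in>D. squeezing_function D z)"
    by (rule cINF_greatest[OF D(3) squeezing_function_lower_bound[OF D(1,2) assms(5,4)]])
  finally show ?thesis
    using assms(3) by (simp add: holomorphic_homogeneous_regular_def)
qed

end
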